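(* For every integer $n\ge 0$, $$ H_n( x ) = (-1)^n (2n+1) \sum_{i=0}^{n}\frac{(n+i)!\,2^i (x-2)^i}{(n-i)!\, (2i+1)!}. $$
   Context: For $k\ge 0$ let $a_k(x)=\sum_{m=0}^{k}\binom{2k+1-m}{k-m}x^m$, and for $n\ge 0$ let $H_n(x)=\det[a_{i+j}(x)]_{0\le i,j\le n}$ be the $(n+1)\times(n+1)$ Hankel determinant. *)

theory Defs
  imports Complex_Main "HOL-Computational_Algebra.Polynomial" "Jordan_Normal_Form.Determinant"
begin

(* The indeterminate x is represented by the polynomial variable, so that identities between the
   objects below are identities of polynomials; x - 2 is then [:-2, 1:].
   Truncated subtraction is harmless, since m <= k. *)
definition a_poly :: "nat \<Rightarrow> 'a::comm_ring_1 poly" where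
  "a_poly k = (\<Sum>m\<le>k. monom (of_nat ((2 * k + 1 - m) choose (k - m))) m)"

definition H_poly :: "nat \<Rightarrow> 'a::comm_ring_1 poly" where
  "H_poly n = det (mat (n + 1) (n + 1) (\<lambda>(i, j). a_poly (i + j)))"

end

theory Submission
  imports Defs
begin

text \<open>
  Put \<open>c = x - 1\<close> and \<open>y = (1 + z)^2 / z = z + 2 + 1/z\<close>. Reading the binomial coefficients as
  coefficients of powers of \<open>1 + z\<close> shows that \<open>a_k\<close> is the constant term of
  \<open>y^(k+1) z / (1 - c z)\<close>. So \<open>a_k = L(y^k)\<close> for the linear functional
  \<open>L(p) = CT (p(y) y z / (1 - c z))\<close> on polynomials in \<open>y\<close>, and the Hankel determinant is
  the Gram determinant of the bilinear form \<open>L(p q)\<close> in the basis of the monomials. It does not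
  change when the monomials are replaced by another sequence of monic polynomials, one in each
  degree (\<open>det_monic_change_of_basis\<close>).

  Let \<open>q_i(y)\<close> be the Laurent polynomial
  \<open>(z^(i+1/2) + z^(-i-1/2)) / (z^(1/2) + z^(-1/2))\<close>, a shifted Chebyshev polynomial of the third
  kind. As \<open>y\<close> is the square of \<open>z^(1/2) + z^(-1/2)\<close>, the factor \<open>y\<close> in \<open>L\<close> cancels
  both denominators:
  \<open>y q_i q_j = z^(i+j+1) + z^(-i-j-1) + z^(i-j) + z^(j-i)\<close> (\<open>poly_act_third_cheb_prod\<close>). Hence,
  with \<open>h_l\<close> the coefficient of \<open>z^l\<close> in \<open>z / (1 - c z)\<close>,
  \<open>L(q_i q_j) = h_(i+j+1) + h_(i-j) + h_(j-i)\<close>. Since \<open>h\<close> is a geometric sequence with ratio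
  \<open>c\<close>, passing to \<open>q_i - c q_(i-1)\<close> makes the Gram matrix tridiagonal, with diagonal
  \<open>1, -2c, -2c, ...\<close> and ones next to the diagonal (\<open>poly_act_tridiag_poly\<close>).

  The determinants \<open>H_n\<close> therefore satisfy \<open>H_(n+2) = -2c H_(n+1) - H_n\<close>. Expanded in powers
  of \<open>c - 1 = x - 2\<close>, the solution has the coefficients
  \<open>(-1)^n 2^i (C(n+i, 2i) + 2 C(n+i, 2i+1))\<close>, because the second difference in \<open>n\<close> of this
  combination of binomial coefficients lowers \<open>i\<close> by one (\<open>hankel_coeff_rec\<close>).
\<close>

section \<open>Two-sided sequences and multiplication by \<open>(1 + z)^2 / z\<close>\<close>

text \<open>
  A sequence \<open>f\<close> indexed by the integers stands for the Laurent series with coefficients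
  \<open>f l\<close>. The next two operators are the multiplications by \<open>1 + z\<close> and by \<open>(1 + z)^2 / z\<close>.
\<close>

definition add_shift :: "(int \<Rightarrow> 'r::comm_ring_1) \<Rightarrow> int \<Rightarrow> 'r" where
  "add_shift f l = f l + f (l - 1)"

definition sym_shift :: "(int \<Rightarrow> 'r::comm_ring_1) \<Rightarrow> int \<Rightarrow> 'r" where
  "sym_shift f l = f (l + 1) + 2 * f l + f (l - 1)"

text \<open>The coefficients of \<open>z / (1 - c z)\<close>.\<close>

definition geom_seq :: "'r::comm_ring_1 \<Rightarrow> int \<Rightarrow> 'r" where
  "geom_seq c l = (if l \<ge> 1 then c ^ nat (l - 1) else 0)"

lemma add_shift_Suc:
  "(add_shift ^^ Suc k) f l = (add_shift ^^ k) f l + (add_shift ^^ k) f (l - 1)"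
  by (simp add: add_shift_def)

lemma sym_shift_Suc:
  "(sym_shift ^^ Suc k) f l =
     (sym_shift ^^ k) f (l + 1) + 2 * (sym_shift ^^ k) f l + (sym_shift ^^ k) f (l - 1)"
  by (simp add: sym_shift_def)

lemma geom_seq_nonpos: "l \<le> 0 \<Longrightarrow> geom_seq c l = 0"
  by (simp add: geom_seq_def)

lemma geom_seq_one: "geom_seq c 1 = 1"
  by (simp add: geom_seq_def)

lemma geom_seq_step:
  assumes "l \<ge> 1"
  shows "geom_seq c (l + 1) = c * geom_seq c l"
proof -
  have "nat l = Suc (nat (l - 1))" using assms by simp
  then show ?thesis using assms by (simp add: geom_seq_def)
qed

text \<open>This is \<open>((1 + z)^2 / z)^k = z^(-k) (1 + z)^(2k)\<close>.\<close>

lemma sym_shift_funpow: "(sym_shift ^^ k) f l = (add_shift ^^ (2 * k)) f (l + int k)"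
proof (induction k arbitrary: l)
  case (Suc k)
  have "2 * Suc k = Suc (Suc (2 * k))" by simp
  then show ?case
    by (simp only: sym_shift_Suc add_shift_Suc Suc.IH) (simp add: algebra_simps)
qed simp

lemma add_shift_geom_nonpos: "l \<le> 0 \<Longrightarrow> (add_shift ^^ N) (geom_seq c) l = 0"
  by (induction N arbitrary: l) (simp_all add: geom_seq_nonpos add_shift_Suc del: funpow.simps(2))

text \<open>Read off at \<open>z^(k+1)\<close>: \<open>z (1 + z)^N / (1 - c z)\<close> is \<open>c z\<close> times itself plus
  \<open>z (1 + z)^N\<close>.\<close>

lemma add_shift_geom_step:
  "(add_shift ^^ N) (geom_seq c) (int k + 1) =
     c * (add_shift ^^ N) (geom_seq c) (int k) + of_nat (N choose k)"
proof (induction N arbitrary: k)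
  case 0
  show ?case
    by (cases k) (use geom_seq_step[of "int k" c] in
      \<open>simp_all add: geom_seq_nonpos geom_seq_one\<close>)
next
  case (Suc N)
  show ?case
  proof (cases k)
    case 0
    then show ?thesis
      using Suc.IH[of 0]
      by (simp add: add_shift_Suc add_shift_geom_nonpos del: funpow.simps(2))
  next
    case (Suc k')
    then show ?thesis
      using Suc.IH[of k] Suc.IH[of k']
      by (simp add: add_shift_Suc algebra_simps del: funpow.simps(2))
  qed
qed

text \<open>
  Adding \<open>z\<close> times the series to the relation above gives
  \<open>z (1 + z)^(N+1) / (1 - c z) = z ((c + 1) z (1 + z)^N / (1 - c z) + (1 + z)^N)\<close>. Iterating it
  produces powers of \<open>c + 1\<close> and lowers \<open>N\<close> and the exponent of \<open>z\<close> together.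
\<close>

lemma add_shift_geom_sum:
  assumes "k \<le> N"
  shows "(add_shift ^^ Suc N) (geom_seq c) (int k + 1) =
     (\<Sum>m\<le>k. (c + 1) ^ m * of_nat ((N - m) choose (k - m)))"
proof -
  have rec: "(add_shift ^^ Suc N) (geom_seq c) (int k + 1) =
      (c + 1) * (add_shift ^^ N) (geom_seq c) (int k) + of_nat (N choose k)" for N k
    using add_shift_geom_step[of N c k] by (simp add: add_shift_Suc algebra_simps del: funpow.simps(2))
  show ?thesis
    using assms
  proof (induction k arbitrary: N)
    case 0
    then show ?case using rec[of N 0] by (simp add: add_shift_geom_nonpos)
  next
    case (Suc k)
    then obtain N' where N: "N = Suc N'" "k \<le> N'" by (cases N) auto
    have "(add_shift ^^ Suc N) (geom_seq c) (int (Suc k) + 1) =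
      (c + 1) * (add_shift ^^ Suc N') (geom_seq c) (int k + 1) + of_nat (N choose Suc k)"
      using rec[of N "Suc k"] by (simp only: N) (simp add: add.commute)
    also have "\<dots> = (\<Sum>m\<le>Suc k. (c + 1) ^ m * of_nat ((N - m) choose (Suc k - m)))"
      by (simp only: Suc.IH[OF N(2)] sum.atMost_Suc_shift)
         (simp add: N sum_distrib_left mult.assoc)
    finally show ?case .
  qed
qed

lemma sym_shift_geom_moment:
  "(sym_shift ^^ Suc k) (geom_seq c) 0 =
     (\<Sum>m\<le>k. (c + 1) ^ m * of_nat ((2 * k + 1 - m) choose (k - m)))"
proof -
  have "(sym_shift ^^ Suc k) (geom_seq c) 0 =
      (add_shift ^^ Suc (2 * k + 1)) (geom_seq c) (int k + 1)"
    by (simp only: sym_shift_funpow) (simp add: add.commute)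
  also have "\<dots> = (\<Sum>m\<le>k. (c + 1) ^ m * of_nat ((2 * k + 1 - m) choose (k - m)))"
    by (rule add_shift_geom_sum) simp
  finally show ?thesis .
qed

section \<open>Polynomials acting on sequences\<close>

text \<open>
  The coefficient sequence of \<open>p(y) f\<close>, where \<open>y = (1 + z)^2 / z\<close> and \<open>f\<close> is the series with
  coefficients \<open>f l\<close>.
\<close>

definition poly_act :: "'r::comm_ring_1 poly \<Rightarrow> (int \<Rightarrow> 'r) \<Rightarrow> int \<Rightarrow> 'r" where
  "poly_act p f l = (\<Sum>k\<le>degree p. coeff p k * (sym_shift ^^ k) f l)"

lemma poly_act_bound:
  assumes "degree p \<le> n"
  shows "poly_act p f l = (\<Sum>k\<le>n. coeff p k * (sym_shift ^^ k) f l)"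
  unfolding poly_act_def using assms
  by (intro sum.mono_neutral_left) (auto intro: le_degree)

lemma poly_act_diff: "poly_act (p - q) f l = poly_act p f l - poly_act q f l"
proof -
  let ?n = "max (degree p) (degree q)"
  show ?thesis
    by (subst (1 2 3) poly_act_bound[of _ ?n])
       (auto simp: degree_diff_le algebra_simps sum_subtractf)
qed

lemma poly_act_smult: "poly_act (smult a p) f l = a * poly_act p f l"
  by (subst poly_act_bound[OF degree_smult_le])
     (simp add: poly_act_def sum_distrib_left mult.assoc)

lemma poly_act_add: "poly_act (p + q) f l = poly_act p f l + poly_act q f l"
proof -
  have "poly_act (- q) f l = - poly_act q f l"
    using poly_act_smult[of "- 1" q f l] by simp
  then show ?thesis using poly_act_diff[of p "- q" f l] by simp
qed

lemma poly_act_one: "poly_act 1 f l = f l"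
  by (simp add: poly_act_def)

lemma poly_act_pCons: "poly_act (pCons a p) f l = a * f l + sym_shift (poly_act p f) l"
proof -
  have "poly_act (pCons a p) f l =
      (\<Sum>k\<le>Suc (degree p). coeff (pCons a p) k * (sym_shift ^^ k) f l)"
    by (rule poly_act_bound) (rule degree_pCons_le)
  also have "\<dots> = a * f l + (\<Sum>k\<le>degree p. coeff p k * sym_shift ((sym_shift ^^ k) f) l)"
    by (subst sum.atMost_Suc_shift) simp
  also have "(\<Sum>k\<le>degree p. coeff p k * sym_shift ((sym_shift ^^ k) f) l) =
      sym_shift (poly_act p f) l"
    by (simp add: poly_act_def sym_shift_def algebra_simps sum.distrib sum_distrib_left)
  finally show ?thesis .
qed

lemma sym_shift_funpow_lincomb:
  "(sym_shift ^^ k) (\<lambda>l. \<Sum>m\<in>A. b m * F m l) l = (\<Sum>m\<in>A. b m * (sym_shift ^^ k) (F m) l)"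
proof (induction k arbitrary: l)
  case (Suc k)
  show ?case
    by (simp only: sym_shift_Suc Suc.IH)
       (simp add: algebra_simps sum.distrib sum_distrib_left)
qed simp

text \<open>
  At \<open>l = 0\<close> this is the bilinear form of the Hankel matrix with entries
  \<open>(sym_shift ^^ (k + m)) f 0\<close>.
\<close>

lemma poly_act_twice:
  assumes "degree p < n" "degree q < n"
  shows "poly_act p (poly_act q f) l =
    (\<Sum>k<n. coeff p k * (\<Sum>m<n. coeff q m * (sym_shift ^^ (k + m)) f l))"
proof -
  obtain n' where n: "n = Suc n'" using assms by (cases n) auto
  have q: "poly_act q f = (\<lambda>l. \<Sum>m<n. coeff q m * (sym_shift ^^ m) f l)"
    using assms by (auto simp: n lessThan_Suc_atMost poly_act_bound[of q n'])
  have "poly_act p (poly_act q f) l = (\<Sum>k<n. coeff p k * (sym_shift ^^ k) (poly_act q f) l)"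
    using assms by (auto simp: n lessThan_Suc_atMost poly_act_bound[of p n'])
  then show ?thesis
    by (simp add: q sym_shift_funpow_lincomb funpow_add)
qed

lemma poly_act_diff_right:
  "poly_act p (\<lambda>l. f l - b * g l) l = poly_act p f l - b * poly_act p g l"
proof -
  have "(sym_shift ^^ k) (\<lambda>l. f l - b * g l) l =
      (sym_shift ^^ k) f l - b * (sym_shift ^^ k) g l" for k l
  proof (induction k arbitrary: l)
    case (Suc k)
    show ?case by (simp only: sym_shift_Suc Suc.IH) (simp add: algebra_simps)
  qed simp
  then show ?thesis
    by (simp only: poly_act_def) (simp add: algebra_simps sum_subtractf sum_distrib_left)
qed

section \<open>A basis that makes the Gram matrix tridiagonal\<close>

text \<open>
  Chebyshev polynomials of the third kind in \<open>(y - 2) / 2 = (z + 1/z) / 2\<close>. They are monic, and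
  under \<open>y = (1 + z)^2 / z\<close> the \<open>n\<close>-th one is the alternating sum
  \<open>z^n - z^(n-1) + ... + z^(-n)\<close>.
\<close>

fun third_cheb :: "nat \<Rightarrow> 'r::comm_ring_1 poly" where
  "third_cheb 0 = 1"
| "third_cheb (Suc 0) = [:- 3, 1:]"
| "third_cheb (Suc (Suc n)) = [:- 2, 1:] * third_cheb (Suc n) - third_cheb n"

lemma degree_third_cheb: "degree (third_cheb n :: 'r::comm_ring_1 poly) \<le> n"
proof (induction n rule: third_cheb.induct)
  case (3 n)
  have "degree ([:- 2, 1:] * third_cheb (Suc n) :: 'r poly) \<le> Suc (Suc n)"
    using degree_mult_le[of "[:- 2, 1:]" "third_cheb (Suc n) :: 'r poly"] 3 by simp
  then show ?case using 3 by (simp only: third_cheb.simps) (rule degree_diff_le, auto)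
qed auto

lemma coeff_third_cheb_self: "coeff (third_cheb n) n = 1"
proof (induction n rule: third_cheb.induct)
  case (3 n)
  then show ?case
    by (simp add: coeff_eq_0 degree_third_cheb le_imp_less_Suc less_SucI
        order.strict_trans1[OF degree_third_cheb])
qed auto

lemma poly_act_third_cheb_Suc:
  "poly_act (third_cheb (Suc (Suc n))) f l =
     poly_act (third_cheb (Suc n)) f (l + 1) + poly_act (third_cheb (Suc n)) f (l - 1)
     - poly_act (third_cheb n) f l"
  by (simp only: third_cheb.simps mult_pCons_left poly_act_diff poly_act_add poly_act_smult
        poly_act_pCons sym_shift_def)
     (simp add: poly_act_def)

lemma poly_act_third_cheb_1:
  "poly_act (third_cheb (Suc 0)) f l = f (l + 1) - f l + f (l - 1)"
  by (simp add: poly_act_pCons poly_act_one sym_shift_def one_pCons poly_act_def)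

text \<open>This is \<open>y q_i = z^(i+1) + z^i + z^(-i) + z^(-i-1)\<close>.\<close>

lemma poly_act_third_cheb_sym_shift:
  "poly_act (third_cheb i) (sym_shift f) l =
     f (l + int i + 1) + f (l + int i) + f (l - int i) + f (l - int i - 1)"
proof (induction i arbitrary: l rule: third_cheb.induct)
  case 1
  then show ?case by (simp add: poly_act_one sym_shift_def)
next
  case 2
  then show ?case by (simp add: poly_act_third_cheb_1 sym_shift_def algebra_simps del: third_cheb.simps)
next
  case (3 n)
  then show ?case by (simp add: poly_act_third_cheb_Suc algebra_simps del: third_cheb.simps)
qed

lemma poly_act_third_cheb_prod:
  "poly_act (third_cheb j) (poly_act (third_cheb i) (sym_shift f)) l =
     f (l + int i + int j + 1) + f (l - int i - int j - 1)
     + f (l + int i - int j) + f (l + int j - int i)"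
proof (induction j arbitrary: l rule: third_cheb.induct)
  case 1
  then show ?case by (simp add: poly_act_one poly_act_third_cheb_sym_shift)
next
  case 2
  then show ?case
    by (simp add: poly_act_third_cheb_1 poly_act_third_cheb_sym_shift algebra_simps
        del: third_cheb.simps)
next
  case (3 n)
  then show ?case by (simp add: poly_act_third_cheb_Suc algebra_simps del: third_cheb.simps)
qed

text \<open>The polynomials \<open>q_i - c q_(i-1)\<close>, where \<open>q_(-1)\<close> is read as \<open>0\<close>.\<close>

definition tridiag_poly :: "'r::comm_ring_1 \<Rightarrow> nat \<Rightarrow> 'r poly" where
  "tridiag_poly c i = (if i = 0 then 1 else third_cheb i - smult c (third_cheb (i - 1)))"

lemma degree_tridiag_poly: "degree (tridiag_poly c i) \<le> i"
proof -
  have "degree (smult c (third_cheb (i - 1))) \<le> i"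
    using degree_smult_le[of c "third_cheb (i - 1)"] degree_third_cheb[of "i - 1", where 'r='a]
    by linarith
  then show ?thesis
    by (auto simp: tridiag_poly_def intro: degree_diff_le degree_third_cheb)
qed

lemma coeff_tridiag_poly_self: "coeff (tridiag_poly c i) i = 1"
proof (cases i)
  case (Suc i')
  then have "degree (third_cheb i' :: 'a poly) < i"
    using degree_third_cheb[of i', where 'r='a] by simp
  then show ?thesis
    by (simp add: tridiag_poly_def Suc coeff_third_cheb_self coeff_eq_0)
qed (simp add: tridiag_poly_def)

text \<open>The entries of the Gram matrix of these polynomials.\<close>

definition tridiag_entry :: "'r::comm_ring_1 \<Rightarrow> nat \<Rightarrow> nat \<Rightarrow> 'r" where
  "tridiag_entry c i j =
     (if i = j then if i = 0 then 1 else - 2 * c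
      else if i = Suc j \<or> j = Suc i then 1 else 0)"

lemma poly_act_tridiag_poly:
  fixes c :: "'r::comm_ring_1"
  shows "poly_act (tridiag_poly c j) (poly_act (tridiag_poly c i) (sym_shift (geom_seq c))) 0 =
     tridiag_entry c i j"
proof -
  let ?h = "geom_seq c"
  define M where "M i j = ?h (int i + int j + 1) + ?h (int i - int j) + ?h (int j - int i)" for i j
  have M: "poly_act (third_cheb j) (poly_act (third_cheb i) (sym_shift ?h)) 0 = M i j" for i j
    by (simp add: poly_act_third_cheb_prod M_def geom_seq_nonpos algebra_simps)
  have step: "?h (1 + l) = c * ?h l" if "l \<ge> 1" for l
    using geom_seq_step[OF that, of c] by (simp add: add.commute)
  have gr: "tridiag_poly c (Suc i) = third_cheb (Suc i) - smult c (third_cheb i)"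
    and gr0: "tridiag_poly c 0 = third_cheb 0" for i
    by (simp_all add: tridiag_poly_def)
  have fn: "poly_act (tridiag_poly c (Suc i)) f =
     (\<lambda>l. poly_act (third_cheb (Suc i)) f l - c * poly_act (third_cheb i) f l)" for i f
    by (rule ext) (simp only: gr poly_act_diff poly_act_smult)
  note expand = fn gr0 poly_act_diff_right M
  have first_row: "M 0 (Suc j) - c * M 0 j = (if j = 0 then 1 else 0)" for j
  proof (cases j)
    case 0
    then show ?thesis using step[of 1]
      by (simp add: M_def geom_seq_nonpos geom_seq_one algebra_simps)
  next
    case (Suc j')
    then show ?thesis using step[of "int j' + 1"] step[of "int j' + 2"]
      by (simp add: M_def geom_seq_nonpos algebra_simps)
  qed
  have M_sym: "M i j = M j i" for i j by (simp add: M_def algebra_simps)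
  \<comment> \<open>In the difference taken along both indices, the part of \<open>M\<close> that depends on \<open>i + j\<close>
    cancels, and the rest depends on \<open>i - j\<close> only.\<close>
  define T where "T s = ?h s - c * ?h (s - 1) - c * ?h (s + 1) + c\<^sup>2 * ?h s" for s :: int
  have inner: "(M (Suc i) (Suc j) - c * M i (Suc j)) - c * (M (Suc i) j - c * M i j) =
      T (int i - int j) + T (int j - int i)" for i j
    using step[of "int i + int j + 1"] step[of "int i + int j + 2"]
    by (simp add: M_def T_def algebra_simps power2_eq_square)
  have T_neg: "T s = 0" if "s < 0" for s using that by (simp add: T_def geom_seq_nonpos)
  have T_0: "T 0 = - c" by (simp add: T_def geom_seq_nonpos geom_seq_one)
  have T_1: "T 1 = 1"
    using step[of 1] by (simp add: T_def geom_seq_nonpos geom_seq_one power2_eq_square)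
  have T_2: "T s = 0" if "s \<ge> 2" for s
    using that step[of "s - 1"] step[of s]
    by (simp add: T_def power2_eq_square algebra_simps)
  have T_sum: "T (int i - int j) + T (int j - int i) = tridiag_entry c (Suc i) (Suc j)" for i j
  proof -
    consider "i = j" | "i = Suc j" | "j = Suc i" | "i \<ge> j + 2" | "j \<ge> i + 2" by linarith
    then show ?thesis
      by cases (simp_all add: tridiag_entry_def T_0 T_1 T_neg T_2)
  qed
  show ?thesis
  proof (cases i; cases j)
    fix i' j' assume "i = Suc i'" "j = Suc j'"
    then show ?thesis
      using inner[of i' j'] T_sum[of i' j'] by (simp add: expand del: third_cheb.simps)
  next
    fix j' assume "i = 0" "j = Suc j'"
    then show ?thesis
      using first_row[of j'] by (simp add: expand tridiag_entry_def del: third_cheb.simps)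
  next
    fix i' assume "i = Suc i'" "j = 0"
    then show ?thesis
      using first_row[of i'] M_sym
      by (simp add: expand tridiag_entry_def del: third_cheb.simps)
  next
    assume "i = 0" "j = 0"
    then show ?thesis
      by (simp add: expand tridiag_entry_def M_def geom_seq_nonpos geom_seq_one del: third_cheb.simps)
  qed
qed

section \<open>Hankel and tridiagonal determinants\<close>

lemma det_monic_change_of_basis:
  fixes b :: "nat \<Rightarrow> 'r::comm_ring_1 poly" and a :: "nat \<Rightarrow> 'r"
  assumes deg: "\<And>i. degree (b i) \<le> i" and monic: "\<And>i. coeff (b i) i = 1"
  shows "det (mat n n (\<lambda>(i, j). \<Sum>k<n. coeff (b i) k * (\<Sum>m<n. coeff (b j) m * a (k + m)))) =
    det (mat n n (\<lambda>(i, j). a (i + j)))"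
proof -
  define P where "P = mat n n (\<lambda>(i, k). coeff (b i) k)"
  define A where "A = mat n n (\<lambda>(i, j). a (i + j))"
  have P: "P \<in> carrier_mat n n" and A: "A \<in> carrier_mat n n"
    by (simp_all add: P_def A_def)
  have "det P = prod_list (diag_mat P)"
  proof (rule det_lower_triangular[OF _ P])
    fix i j assume "i < j" "j < n"
    then show "P $$ (i, j) = 0"
      using deg[of i] by (simp add: P_def coeff_eq_0)
  qed
  also have "diag_mat P = map (\<lambda>i. 1) [0..<n]"
    by (simp add: diag_mat_def P_def monic)
  finally have det_P: "det P = 1"
    by (simp add: map_replicate_const)
  have "mat n n (\<lambda>(i, j). \<Sum>k<n. coeff (b i) k * (\<Sum>m<n. coeff (b j) m * a (k + m))) =
      P * (A * transpose_mat P)"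
    by (rule eq_matI)
       (simp_all add: P_def A_def scalar_prod_def lessThan_atLeast0 mult.commute)
  then show ?thesis
    using P A det_P by (simp add: det_mult[of _ n] det_transpose A_def[symmetric])
qed

text \<open>The tridiagonal matrix with diagonal \<open>d\<close> and ones next to the diagonal.\<close>

definition continuant_mat :: "(nat \<Rightarrow> 'r::comm_ring_1) \<Rightarrow> nat \<Rightarrow> 'r mat" where
  "continuant_mat d n =
     mat n n (\<lambda>(i, j). if i = j then d i else if i = Suc j \<or> j = Suc i then 1 else 0)"

lemma det_continuant_mat_rec:
  "det (continuant_mat d (Suc (Suc n))) =
     d (Suc n) * det (continuant_mat d (Suc n)) - det (continuant_mat d n)"
proof -
  let ?A = "continuant_mat d (Suc (Suc n))"
  have A: "?A \<in> carrier_mat (Suc (Suc n)) (Suc (Suc n))"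
    by (simp add: continuant_mat_def)
  \<comment> \<open>Laplace expansion along the last row; the minor \<open>B\<close> is expanded along its last column.\<close>
  have min1: "mat_delete ?A (Suc n) (Suc n) = continuant_mat d (Suc n)"
    by (rule eq_matI) (simp_all add: mat_delete_def continuant_mat_def)
  define B where "B = mat_delete ?A (Suc n) n"
  have B: "B \<in> carrier_mat (Suc n) (Suc n)"
    by (simp add: B_def mat_delete_def continuant_mat_def)
  have min2: "mat_delete B n n = continuant_mat d n"
    by (rule eq_matI) (simp_all add: B_def mat_delete_def continuant_mat_def)
  have col: "B $$ (i, n) = (if i = n then 1 else 0)" if "i < Suc n" for i
    using that by (simp add: B_def mat_delete_def continuant_mat_def)
  have "det B = (\<Sum>i<Suc n. B $$ (i, n) * cofactor B i n)"
    by (rule laplace_expansion_column[OF B]) simp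
  also have "\<dots> = (\<Sum>i<n. 0) + cofactor B n n"
    by (simp add: col)
  finally have det_B: "det B = det (continuant_mat d n)"
    by (simp add: cofactor_def min2)
  have row: "?A $$ (Suc n, j) = (if j = Suc n then d (Suc n) else if j = n then 1 else 0)"
    if "j < Suc (Suc n)" for j
    using that by (simp add: continuant_mat_def)
  have "det ?A = (\<Sum>j<Suc (Suc n). ?A $$ (Suc n, j) * cofactor ?A (Suc n) j)"
    by (rule laplace_expansion_row[OF A]) simp
  also have "\<dots> = d (Suc n) * cofactor ?A (Suc n) (Suc n) + cofactor ?A (Suc n) n"
    by (simp add: row)
  finally show ?thesis
    by (simp add: cofactor_def min1 det_B B_def[symmetric])
qed

section \<open>The coefficients in powers of \<open>x - 2\<close>\<close>

text \<open>
  Up to the factor \<open>(-1)^n 2^i\<close>, the coefficient of \<open>(x - 2)^i\<close> in \<open>H_n\<close>. As a sum of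
  binomial coefficients it is defined without division and vanishes for \<open>i > n\<close>.
\<close>

definition hankel_coeff :: "nat \<Rightarrow> nat \<Rightarrow> nat" where
  "hankel_coeff n i = ((n + i) choose (2 * i)) + 2 * ((n + i) choose (2 * i + 1))"

lemma hankel_coeff_eq_0: "n < i \<Longrightarrow> hankel_coeff n i = 0"
  by (simp add: hankel_coeff_def binomial_eq_0)

lemma hankel_coeff_0: "hankel_coeff n 0 = 2 * n + 1"
  by (simp add: hankel_coeff_def)

lemma hankel_coeff_rec:
  "hankel_coeff (Suc (Suc n)) (Suc i) + hankel_coeff n (Suc i) =
     hankel_coeff (Suc n) i + 2 * hankel_coeff (Suc n) (Suc i)"
  by (simp add: hankel_coeff_def)

lemma hankel_coeff_fact:
  assumes "i \<le> n"
  shows "(of_nat (hankel_coeff n i) :: 'a::field_char_0) =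
    of_nat (2 * n + 1) * (fact (n + i) / (fact (n - i) * fact (2 * i + 1)))"
proof (cases "i = n")
  case True
  have "(fact (2 * n + 1) :: 'a) = of_nat (2 * n + 1) * fact (2 * n)"
    by simp
  moreover have "hankel_coeff n i = 1"
    by (simp add: hankel_coeff_def True mult_2[symmetric] binomial_eq_0)
  moreover have "(of_nat (2 * n + 1) :: 'a) \<noteq> 0"
    by (subst of_nat_eq_0_iff) simp
  ultimately show ?thesis
    by (simp add: True mult_2[symmetric] del: fact_Suc of_nat_add of_nat_Suc)
next
  case False
  then obtain k where n: "n = i + Suc k"
    using assms less_imp_Suc_add[of i n] by auto
  have 1: "(of_nat ((n + i) choose (2 * i)) :: 'a) = fact (n + i) / (fact (2 * i) * fact (n - i))"
    by (subst binomial_fact) (simp_all add: n)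
  have 2: "(of_nat ((n + i) choose (2 * i + 1)) :: 'a) =
      fact (n + i) / (fact (2 * i + 1) * fact k)"
    by (subst binomial_fact) (simp_all add: n)
  have 3: "(fact (n - i) :: 'a) = of_nat (Suc k) * fact k" by (simp add: n)
  have 4: "(fact (2 * i + 1) :: 'a) = of_nat (2 * i + 1) * fact (2 * i)" by simp
  have nz: "(of_nat (Suc k) :: 'a) \<noteq> 0" "(of_nat (2 * i + 1) :: 'a) \<noteq> 0"
    by (simp_all only: of_nat_eq_0_iff)
  have "(of_nat (hankel_coeff n i) :: 'a) =
      fact (n + i) / (fact (2 * i) * fact (n - i)) + 2 * (fact (n + i) / (fact (2 * i + 1) * fact k))"
    by (simp only: hankel_coeff_def of_nat_add of_nat_mult 1 2 of_nat_numeral)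
  also have "\<dots> = (of_nat (2 * i + 1) + 2 * of_nat (Suc k)) *
      (fact (n + i) / (fact (n - i) * fact (2 * i + 1)))"
    unfolding 3 4 using nz by (simp add: divide_simps del: of_nat_Suc fact_Suc) (simp add: algebra_simps)
  also have "of_nat (2 * i + 1) + 2 * of_nat (Suc k) = (of_nat (2 * n + 1) :: 'a)"
    by (simp add: n algebra_simps)
  finally show ?thesis .
qed

lemma det_continuant_mat_sum:
  fixes c :: "'r::comm_ring_1"
  defines "d \<equiv> \<lambda>i::nat. if i = 0 then 1 else - 2 * c"
  shows "det (continuant_mat d (Suc n)) =
    (- 1) ^ n * (\<Sum>i\<le>n. of_nat (hankel_coeff n i) * 2 ^ i * (c - 1) ^ i)"
proof -
  \<comment> \<open>The upper limit is kept apart from \<open>n\<close>, so that sums for different \<open>n\<close> share a range.\<close>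
  define S where "S N n = (\<Sum>i\<le>N. of_nat (hankel_coeff n i) * 2 ^ i * (c - 1) ^ i)" for N n
  have S_bound: "S N n = S n n" if "n \<le> N" for N n
    unfolding S_def using that
    by (intro sum.mono_neutral_right) (auto simp: hankel_coeff_eq_0)
  have S_rec: "S (Suc N) (Suc (Suc n)) + S (Suc N) n =
      2 * S (Suc N) (Suc n) + 2 * (c - 1) * S N (Suc n)" for N n
  proof -
    have "of_nat (hankel_coeff (Suc (Suc n)) (Suc i)) + of_nat (hankel_coeff n (Suc i)) =
       (of_nat (hankel_coeff (Suc n) i) + 2 * of_nat (hankel_coeff (Suc n) (Suc i)) :: 'r)" for i
      using arg_cong[OF hankel_coeff_rec[of n i], of "of_nat :: nat \<Rightarrow> 'r"] by simp
    then have e: "(of_nat (hankel_coeff (Suc (Suc n)) (Suc i)) :: 'r) =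
        of_nat (hankel_coeff (Suc n) i) + 2 * of_nat (hankel_coeff (Suc n) (Suc i))
        - of_nat (hankel_coeff n (Suc i))" for i
      by (simp add: eq_diff_eq)
    show ?thesis
      unfolding S_def sum.atMost_Suc_shift e
      by (simp add: hankel_coeff_0 algebra_simps sum.distrib sum_subtractf sum_distrib_left)
  qed
  have rec: "S (Suc (Suc n)) (Suc (Suc n)) = 2 * c * S (Suc n) (Suc n) - S n n" for n
    using S_rec[of "Suc n" n] S_bound[of n "Suc (Suc n)"] S_bound[of "Suc n" "Suc (Suc n)"]
    by (simp add: algebra_simps)
  have "det (continuant_mat d (Suc n)) = (- 1) ^ n * S n n"
  proof (induction n rule: induct_nat_012)
    case 0
    show ?case
      by (simp add: S_def hankel_coeff_0 continuant_mat_def d_def det_single)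
  next
    case 1
    show ?case
      by (simp add: det_continuant_mat_rec)
         (simp add: S_def hankel_coeff_def continuant_mat_def d_def det_single algebra_simps)
  next
    case (ge2 n)
    have "d (Suc (Suc n)) = - 2 * c" by (simp add: d_def)
    then show ?case
      by (simp only: det_continuant_mat_rec[of d "Suc n"] ge2 rec) (simp add: algebra_simps)
  qed
  then show ?thesis by (simp add: S_def)
qed

section \<open>The Hankel determinant\<close>

lemma det_hankel:
  fixes c :: "'r::comm_ring_1"
  defines "a \<equiv> \<lambda>k. \<Sum>m\<le>k. (c + 1) ^ m * of_nat ((2 * k + 1 - m) choose (k - m))"
  shows "det (mat (n + 1) (n + 1) (\<lambda>(i, j). a (i + j))) =
    (- 1) ^ n * (\<Sum>i\<le>n. of_nat (hankel_coeff n i) * 2 ^ i * (c - 1) ^ i)"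
proof -
  have a: "a k = (sym_shift ^^ k) (sym_shift (geom_seq c)) 0" for k
    using sym_shift_geom_moment[of k c] by (simp add: a_def funpow_swap1)
  have "(\<Sum>k<n + 1. coeff (tridiag_poly c i) k * (\<Sum>m<n + 1. coeff (tridiag_poly c j) m * a (k + m))) =
      tridiag_entry c i j" if "i < n + 1" "j < n + 1" for i j
  proof -
    have "degree (tridiag_poly c i) < n + 1" "degree (tridiag_poly c j) < n + 1"
      using that degree_tridiag_poly[of c i] degree_tridiag_poly[of c j] by simp_all
    from poly_act_twice[OF this, of "sym_shift (geom_seq c)" 0] show ?thesis
      by (simp only: a poly_act_tridiag_poly) (auto simp: tridiag_entry_def)
  qed
  then have "mat (n + 1) (n + 1) (\<lambda>(i, j). \<Sum>k<n + 1. coeff (tridiag_poly c i) k *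
        (\<Sum>m<n + 1. coeff (tridiag_poly c j) m * a (k + m))) =
      continuant_mat (\<lambda>i. if i = 0 then 1 else - 2 * c) (Suc n)"
    by (intro eq_matI) (simp_all add: continuant_mat_def tridiag_entry_def)
  then show ?thesis
    using det_monic_change_of_basis[of "tridiag_poly c" "n + 1" a]
      det_continuant_mat_sum[of c n]
    by (simp add: degree_tridiag_poly coeff_tridiag_poly_self)
qed

lemma smult_sum_right: "smult a (sum f A) = (\<Sum>i\<in>A. smult a (f i))"
  by (induction A rule: infinite_finite_induct) (simp_all add: smult_add_right)

theorem theorem5:
  fixes n :: nat
  shows "(H_poly n :: 'a::field_char_0 poly) =
    smult ((- 1) ^ n * of_nat (2 * n + 1))
      (\<Sum>i\<le>n. smult (fact (n + i) * 2 ^ i / (fact (n - i) * fact (2 * i + 1))) ([:- 2, 1:] ^ i))"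
proof -
  define c :: "'a poly" where "c = [:- 1, 1:]"
  have c1: "c + 1 = [:0, 1:]" and c2: "c - 1 = [:- 2, 1:]"
    by (simp_all add: c_def one_pCons)
  have "a_poly k = (\<Sum>m\<le>k. (c + 1) ^ m * of_nat ((2 * k + 1 - m) choose (k - m)))" for k
    unfolding a_poly_def c1
    by (intro sum.cong refl) (simp add: monom_altdef of_nat_poly)
  then have "H_poly n = (- 1) ^ n * (\<Sum>i\<le>n. of_nat (hankel_coeff n i) * 2 ^ i * (c - 1) ^ i)"
    unfolding H_poly_def by (simp only: det_hankel)
  moreover have "of_nat (hankel_coeff n i) * 2 ^ i * (c - 1) ^ i =
      smult (of_nat (2 * n + 1))
        (smult (fact (n + i) * 2 ^ i / (fact (n - i) * fact (2 * i + 1))) ([:- 2, 1:] ^ i))"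
    if "i \<le> n" for i
  proof -
    have "(of_nat (hankel_coeff n i) * 2 ^ i :: 'a poly) = [:of_nat (hankel_coeff n i) * 2 ^ i:]"
      by (simp add: of_nat_poly numeral_poly poly_const_pow)
    then show ?thesis
      by (simp add: c2 hankel_coeff_fact[OF that] mult.assoc
          del: of_nat_mult of_nat_add of_nat_Suc fact_Suc)
  qed
  then have "(\<Sum>i\<le>n. of_nat (hankel_coeff n i) * 2 ^ i * (c - 1) ^ i) =
      smult (of_nat (2 * n + 1)) (\<Sum>i\<le>n.
        smult (fact (n + i) * 2 ^ i / (fact (n - i) * fact (2 * i + 1))) ([:- 2, 1:] ^ i))"
    by (simp only: smult_sum_right) simp
  moreover have "(- 1) ^ n * smult b p = smult ((- 1) ^ n * b) p" for b :: 'a and p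
    by (cases "even n") simp_all
  ultimately show ?thesis by simp
qed

end
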